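(* For every natural number $m\ge 2$ there is a positive constant $\varphi(m)$ such that for every nonempty compact convex set $\widetilde\Omega\subset\mathbb{R}^m$ with piecewise $C^1$ boundary and every $\delta>0$ with $\delta\ge\varphi(m)\cdot\mathrm{diam}(\widetilde\Omega)$, the parallel body $\widetilde\Omega+\delta B^m$ has a unique $r^{\alpha-m}$-center for every $\alpha>0$.
   Context: $B^m$ is the closed unit ball of $\mathbb{R}^m$, $\widetilde\Omega+\delta B^m=\{x+\delta u : x\in\widetilde\Omega,\ u\in B^m\}$ is the $\delta$-parallel body of $\widetilde\Omega$, and $\mu$ is Lebesgue measure on $\mathbb{R}^m$. A body is a compact set which is the closure of its interior. For a body $\Omega\subset\mathbb{R}^m$ with piecewise $C^1$ boundary and $\alpha>0$ put, for $x\in\mathbb{R}^m$, $V_\Omega^{(\alpha)}(x)=\int_\Omega |x-y|^{\alpha-m}\,d\mu(y)$ and $V_\Omega^{\log}(x)=\int_\Omega\log\frac{1}{|x-y|}\,d\mu(y)$. An $r^{\alpha-m}$-center of $\Omega$ is: a point of $\mathbb{R}^m$ at which $V_\Omega^{(\alpha)}$ attains its minimum value over $\mathbb{R}^m$, if $\alpha>m$; a point at which $V_\Omega^{(\alpha)}$ attains its maximum value over $\mathbb{R}^m$, if $0<\alpha<m$; a point at which $V_\Omega^{\log}$ attains its maximum value over $\mathbb{R}^m$, if $\alpha=m$ (also called an $r^0$-center). *)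

theory Defs
  imports "HOL-Analysis.Analysis"
begin

text \<open>Only used for open \<open>W\<close>; continuity of the derivative is with respect to the operator norm.\<close>

definition C1_on :: "'a::euclidean_space set \<Rightarrow> ('a \<Rightarrow> 'b::euclidean_space) \<Rightarrow> bool" where
  "C1_on W f \<longleftrightarrow>
     (\<exists>f'. (\<forall>x\<in>W. (f has_derivative blinfun_apply (f' x)) (at x)) \<and> continuous_on W f')"

text \<open>Embedded submanifolds without boundary, not necessarily closed: near each of its points,
  \<open>M\<close> is mapped onto an open part of a \<open>k\<close>-dimensional linear subspace by a \<open>C\<^sup>1\<close> diffeomorphism
  between open sets of the ambient space.\<close>

definition C1_submanifold :: "nat \<Rightarrow> 'a::euclidean_space set \<Rightarrow> bool" where
  "C1_submanifold k M \<longleftrightarrow>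
     (\<forall>p\<in>M. \<exists>W W' \<Phi> \<Psi> (L :: 'a set).
        open W \<and> p \<in> W \<and> open W' \<and> homeomorphism W W' \<Phi> \<Psi> \<and> C1_on W \<Phi> \<and> C1_on W' \<Psi> \<and>
        subspace L \<and> dim L = k \<and> \<Phi> ` (M \<inter> W) = W' \<inter> L)"

text \<open>The boundary is partitioned into finitely many connected \<open>C\<^sup>1\<close> pieces: smooth hypersurfaces
  together with the lower-dimensional edges and vertices along which they meet.
  Connectedness of the pieces is what makes finiteness meaningful, since a disconnected
  piece could hide infinitely many vertices or edges.
  Lower-dimensional sets are not excluded; for instance, a singleton is its own boundary and
  consists of one piece of dimension 0.\<close>

definition piecewise_C1_boundary :: "'a::euclidean_space set \<Rightarrow> bool" where
  "piecewise_C1_boundary \<Omega> \<longleftrightarrow>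
     (\<exists>\<S>. finite \<S> \<and> disjoint \<S> \<and> \<Union>\<S> = frontier \<Omega> \<and>
        (\<forall>S\<in>\<S>. connected S \<and> (\<exists>k < DIM('a). C1_submanifold k S)))"

definition parallel_body :: "'a::euclidean_space set \<Rightarrow> real \<Rightarrow> 'a set" where
  "parallel_body \<Omega> \<delta> = {x + \<delta> *\<^sub>R u | x u. x \<in> \<Omega> \<and> u \<in> cball 0 1}"

text \<open>For compact \<open>\<Omega>\<close> and \<open>\<alpha> > 0\<close> both integrands below are integrable on \<open>\<Omega>\<close>, so the convention
  that the integral of a non-integrable function is 0 plays no role; neither do the values
  \<open>0 powr a = 0\<close> and \<open>ln (1 / 0) = 0\<close> taken at the single point \<open>y = x\<close>.\<close>

definition potential :: "real \<Rightarrow> 'a::euclidean_space set \<Rightarrow> 'a \<Rightarrow> real" where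
  "potential \<alpha> \<Omega> x = (LINT y:\<Omega>|lebesgue. norm (x - y) powr (\<alpha> - real DIM('a)))"

definition log_potential :: "'a::euclidean_space set \<Rightarrow> 'a \<Rightarrow> real" where
  "log_potential \<Omega> x = (LINT y:\<Omega>|lebesgue. ln (1 / norm (x - y)))"

text \<open>The parameter is \<open>\<alpha>\<close>, not the exponent: this is the notion of an
  \<open>r\<close>-to-the-power-\<open>(\<alpha> - m)\<close> center, for \<open>\<alpha> > 0\<close>.\<close>

definition is_center :: "real \<Rightarrow> 'a::euclidean_space set \<Rightarrow> 'a \<Rightarrow> bool" where
  "is_center \<alpha> \<Omega> p \<longleftrightarrow>
     (if \<alpha> > real DIM('a) then \<forall>x. potential \<alpha> \<Omega> p \<le> potential \<alpha> \<Omega> x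
      else if \<alpha> < real DIM('a) then \<forall>x. potential \<alpha> \<Omega> x \<le> potential \<alpha> \<Omega> p
      else \<forall>x. log_potential \<Omega> x \<le> log_potential \<Omega> p)"

end

theory Submission imports Defs begin

text \<open>Write \<open>m\<close> for the dimension, \<open>b = \<alpha> - m\<close>, and let \<open>k\<close> be the primitive of \<open>- r powr (b - 1)\<close> given by
  \<open>- (r powr b) / b\<close>, or by \<open>- ln r\<close> if \<open>b = 0\<close>. It is strictly decreasing, and in all three cases of the
  definition a center of \<open>K\<close> is a maximum point of \<open>U x = \<integral>\<^sub>K k \<bar>x - y\<bar> dy\<close>. Let \<open>K\<close> be the parallel body.

  No maximum point lies outside \<open>\<Omega>\<close>: for \<open>x \<notin> \<Omega>\<close> let \<open>z\<close> be the point of \<open>\<Omega>\<close> closest to \<open>x\<close>. All of \<open>\<Omega>\<close> is on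
  the \<open>z\<close>-side of the bisector of \<open>x\<close> and \<open>z\<close>, so reflecting the part of \<open>K\<close> on the \<open>x\<close>-side brings it closer
  to every point of \<open>\<Omega>\<close> and keeps it in \<open>K\<close>. Hence \<open>K\<close> has more mass near \<open>z\<close> than near \<open>x\<close>, and
  \<open>U x < U z\<close> (\<open>riesz_potential_less_closest_point\<close>). As \<open>U\<close> is continuous and \<open>\<Omega>\<close> is compact, a center exists.

  On \<open>\<Omega>\<close> the potential is strictly midpoint concave (\<open>riesz_potential_midpoint_less\<close>), so there is at most
  one center. Let \<open>z\<close> be the midpoint of \<open>z + h\<close> and \<open>z - h\<close> in \<open>\<Omega>\<close>. If \<open>b \<ge> 2\<close>, the second difference of
  the integrand is negative pointwise, because \<open>r powr b\<close> is an increasing convex function of \<open>r\<^sup>2\<close>. If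
  \<open>- m < b \<le> 2\<close>, split \<open>K\<close> into the ball \<open>B\<close> of radius \<open>\<delta>\<close> about \<open>z\<close> and a thin shell around it. On \<open>B\<close>, with
  \<open>\<kappa>\<close> a constant multiple of \<open>\<delta> powr (b - 2)\<close>, even \<open>k r + \<kappa> r\<^sup>2 / 2\<close> is decreasing for \<open>r \<le> 2 \<delta>\<close>.
  Among the points at distance at most \<open>\<delta>\<close> from \<open>z\<close>, the corresponding integral over \<open>B\<close> is therefore
  largest at the centre \<open>z\<close>, and the quadratic term shows that the second difference of the potential of \<open>B\<close> is at most \<open>- \<kappa> \<bar>h\<bar>\<^sup>2 \<bar>B\<bar>\<close>
  (\<open>riesz_potential_cball_centre_drop\<close>). On the shell the kernel is smooth, and its second difference is at
  most a constant multiple of \<open>\<delta> powr (b - 2) * \<bar>h\<bar>\<^sup>2\<close> (\<open>second_difference_le_quadratic\<close>). Both constants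
  depend on \<open>m\<close> only, because \<open>b\<close> ranges over a bounded interval, and the volume of the shell is small
  relative to \<open>\<bar>B\<bar>\<close> as soon as the diameter of \<open>\<Omega>\<close> is small relative to \<open>\<delta>\<close>. So the ball wins, uniformly
  in \<open>\<alpha>\<close>. Comparing integrals over translated balls in this way avoids second derivatives of singular
  integrals.\<close>

section \<open>Orthogonal maps preserve Lebesgue measure\<close>

lemma lborel_distr_plus':
  fixes t :: "'a::euclidean_space"
  shows "distr lborel lborel (\<lambda>z. t + z) = lborel"
  using lborel_distr_plus[of t] by (simp cong: distr_cong)

lemma lborel_distr_minus:
  fixes t :: "'a::euclidean_space"
  shows "distr lborel lborel (\<lambda>z. t - z) = lborel"
proof -
  have "distr lborel lborel (\<lambda>z. t - z) = distr lborel borel (\<lambda>z. t + (-1) *\<^sub>R z)"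
    by (intro distr_cong) auto
  then show ?thesis
    using lborel_affine[of "-1" t] by (simp add: density_1)
qed

lemma nn_integral_lborel_translation:
  fixes f :: "'a::euclidean_space \<Rightarrow> ennreal"
  assumes [measurable]: "f \<in> borel_measurable borel"
  shows "(\<integral>\<^sup>+ z. f (t + z) \<partial>lborel) = (\<integral>\<^sup>+ z. f z \<partial>lborel)"
    and "(\<integral>\<^sup>+ z. f (t - z) \<partial>lborel) = (\<integral>\<^sup>+ z. f z \<partial>lborel)"
  using nn_integral_distr[of "\<lambda>z. t + z" lborel lborel f]
    nn_integral_distr[of "\<lambda>z. t - z" lborel lborel f]
  by (simp_all add: lborel_distr_plus' lborel_distr_minus)

text \<open>This is the uniqueness argument for Haar measure, specialised to the image of Lebesgue measure: evaluating
  \<open>\<integral>\<integral> 1\<^sub>A x * 1\<^sub>B (x + f z) dx dz\<close> in both orders, with translation invariance in each variable, gives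
  \<open>\<lambda> A * \<lambda> (f -` B) = \<lambda> B * \<lambda> (f -` A)\<close>. For the unit ball \<open>B\<close> we have \<open>f -` B = B\<close>, and its finite
  positive measure cancels.\<close>

lemma orthogonal_transformation_preserves_lborel:
  fixes f :: "'a::euclidean_space \<Rightarrow> 'a"
  assumes f: "orthogonal_transformation f"
  shows "distr lborel lborel f = lborel"
proof (rule measure_eqI)
  show "sets (distr lborel lborel f) = sets lborel" by simp
next
  fix A assume "A \<in> sets (distr lborel lborel f)"
  then have A[measurable]: "A \<in> sets borel" by simp
  define B where "B = (ball 0 1 :: 'a set)"
  have [measurable]: "B \<in> sets borel" by (simp add: B_def)
  have lin: "linear f" using f by (rule orthogonal_transformation_linear)
  have [measurable]: "f \<in> borel_measurable borel"
    using linear_continuous_on[of f UNIV] lin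
    by (intro borel_measurable_continuous_onI) (simp add: linear_linear)
  obtain g where g: "\<And>x. f (g x) = x"
    using orthogonal_transformation_surj[OF f] by (metis surjD)
  have fB: "f z \<in> B \<longleftrightarrow> z \<in> B" for z
    using orthogonal_transformation_norm[OF f] by (simp add: B_def)
  have plus: "x + f z = f (g x + z)" for x z by (simp add: linear_add[OF lin] g)
  have minus: "x - f z = f (g x - z)" for x z by (simp add: linear_diff[OF lin] g)
  have "(\<integral>\<^sup>+ x. \<integral>\<^sup>+ z. indicator A x * indicator B (x + f z) \<partial>lborel \<partial>lborel)
      = (\<integral>\<^sup>+ x. indicator A x * (\<integral>\<^sup>+ z. indicator B (f (g x + z)) \<partial>lborel) \<partial>lborel)"
    by (simp add: nn_integral_cmult plus[symmetric])
  also have "\<dots> = (\<integral>\<^sup>+ x. indicator A x * (\<integral>\<^sup>+ z. indicator B (f z) \<partial>lborel) \<partial>lborel)"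
    by (subst nn_integral_lborel_translation(1)[where f = "\<lambda>z. indicator B (f z)"]) auto
  also have "\<dots> = emeasure lborel A * emeasure lborel B"
  proof -
    have "(\<lambda>z. indicator B (f z) :: ennreal) = indicator B" using fB by (auto simp: indicator_def fun_eq_iff)
    then show ?thesis by (simp add: nn_integral_multc)
  qed
  finally have 1: "(\<integral>\<^sup>+ x. \<integral>\<^sup>+ z. indicator A x * indicator B (x + f z) \<partial>lborel \<partial>lborel)
      = emeasure lborel A * emeasure lborel B" .
  have "(\<integral>\<^sup>+ x. \<integral>\<^sup>+ z. indicator A x * indicator B (x + f z) \<partial>lborel \<partial>lborel)
      = (\<integral>\<^sup>+ z. \<integral>\<^sup>+ x. indicator A x * indicator B (x + f z) \<partial>lborel \<partial>lborel)"
    by (rule lborel_pair.Fubini') measurable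
  also have "\<dots> = (\<integral>\<^sup>+ z. \<integral>\<^sup>+ x. indicator A (x - f z) * indicator B x \<partial>lborel \<partial>lborel)"
  proof (rule nn_integral_cong)
    fix z
    show "(\<integral>\<^sup>+ x. indicator A x * indicator B (x + f z) \<partial>lborel)
        = (\<integral>\<^sup>+ x. indicator A (x - f z) * indicator B x \<partial>lborel :: ennreal)"
      using nn_integral_lborel_translation(1)
        [of "\<lambda>x. indicator A x * indicator B (x + f z)" "- f z"] by simp
  qed
  also have "\<dots> = (\<integral>\<^sup>+ x. \<integral>\<^sup>+ z. indicator A (x - f z) * indicator B x \<partial>lborel \<partial>lborel)"
    by (rule lborel_pair.Fubini') measurable
  also have "\<dots> = (\<integral>\<^sup>+ x. (\<integral>\<^sup>+ z. indicator A (f (g x - z)) \<partial>lborel) * indicator B x \<partial>lborel)"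
    by (simp add: nn_integral_multc minus[symmetric])
  also have "\<dots> = (\<integral>\<^sup>+ x. (\<integral>\<^sup>+ z. indicator A (f z) \<partial>lborel) * indicator B x \<partial>lborel)"
    by (subst nn_integral_lborel_translation(2)[where f = "\<lambda>z. indicator A (f z)"]) auto
  also have "\<dots> = (\<integral>\<^sup>+ z. indicator A (f z) \<partial>lborel) * emeasure lborel B"
    by (simp add: nn_integral_cmult)
  also have "(\<integral>\<^sup>+ z. indicator A (f z) \<partial>lborel) = emeasure (distr lborel lborel f) A"
    by (simp add: nn_integral_distr flip: nn_integral_indicator)
  finally have "emeasure (distr lborel lborel f) A * emeasure lborel B
      = emeasure lborel A * emeasure lborel B"
    using 1 by simp
  moreover have "emeasure lborel B \<noteq> 0" "emeasure lborel B \<noteq> \<infinity>"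
    using content_ball_gt_0_iff[of "0::'a" 1]
    by (auto simp: B_def measure_def emeasure_lborel_ball_finite less_top[symmetric])
  ultimately show "emeasure (distr lborel lborel f) A = emeasure lborel A"
    by (simp add: ennreal_mult_cancel_left mult.commute[of _ "emeasure lborel B"])
qed

section \<open>The kernels and their integrability\<close>

lemma exists_dyadic_shell:
  fixes r R :: real
  assumes "0 < r" "r \<le> R"
  shows "\<exists>j. R / 2 ^ Suc j < r \<and> r \<le> R / 2 ^ j"
proof -
  obtain n where "R / r < 2 ^ n"
    using real_arch_pow[of 2 "R / r"] by auto
  then have "R / 2 ^ n < r" using assms by (simp add: field_simps)
  then obtain k where k: "R / 2 ^ k < r" "\<And>i. i < k \<Longrightarrow> \<not> R / 2 ^ i < r"
    using exists_least_iff[of "\<lambda>n. R / 2 ^ n < r"] by blast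
  from k(1) assms obtain j where "k = Suc j" by (cases k) auto
  then show ?thesis using k by (intro exI[of _ j]) (auto simp: not_less)
qed

text \<open>For negative \<open>b\<close> the ball is cut into dyadic shells: halving the radius multiplies the volume by
  \<open>2 powr (- m)\<close> and the integrand by \<open>2 powr (- b)\<close>, so the contributions form a geometric series of
  ratio \<open>2 powr (- (b + m)) < 1\<close>.\<close>

lemma norm_powr_integrable_cball:
  fixes R :: real
  assumes "- real DIM('a::euclidean_space) < b"
  shows "set_integrable lborel (cball 0 R) (\<lambda>y::'a. norm y powr b)"
proof (cases "b < 0 \<and> R > 0")
  case True
  then have b: "b < 0" and R: "R > 0" by auto
  define m where "m = real DIM('a)"
  define v where "v = unit_ball_vol m"
  define C where "C = (R / 2) powr b * (v * R powr m)"
  define q where "q = 2 powr (- (b + m))"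
  have [measurable]: "cball (0::'a) r \<in> sets borel" for r
    by (intro borel_closed closed_cball)
  have C: "C \<ge> 0" using R by (simp add: C_def v_def m_def)
  have q: "0 < q" "q < 1"
    using assms powr_less_cancel_iff[of 2 "-(b+m)" 0] by (auto simp: q_def m_def)
  let ?h = "\<lambda>j (y::'a). ennreal ((R / 2 ^ Suc j) powr b) * indicator (cball 0 (R / 2 ^ j)) y"
  have le: "ennreal (norm (indicat_real (cball 0 R) y *\<^sub>R norm y powr b)) \<le> (\<Sum>j. ?h j y)" for y :: 'a
  proof (cases "y \<noteq> 0 \<and> norm y \<le> R")
    case True
    then obtain j where j: "R / 2 ^ Suc j < norm y" "norm y \<le> R / 2 ^ j"
      using exists_dyadic_shell[of "norm y" R] by auto
    have "norm y powr b \<le> (R / 2 ^ Suc j) powr b"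
      using j b R by (intro powr_mono2') auto
    then have "ennreal (norm (indicat_real (cball 0 R) y *\<^sub>R norm y powr b)) \<le> ?h j y"
      using True j by (auto simp: indicator_def intro!: ennreal_leI)
    also have "\<dots> = (\<Sum>i\<in>{j}. ?h i y)"
      by (simp only: sum.insert[OF finite.emptyI] empty_iff not_False_eq_True sum.empty add_0_right)
    also have "\<dots> \<le> (\<Sum>j. ?h j y)" by (rule sum_le_suminf) auto
    finally show ?thesis .
  qed (auto simp: indicator_def)
  have h: "(\<integral>\<^sup>+ y. ?h j y \<partial>lborel) = ennreal (C * q ^ j)" for j
  proof -
    have "(\<integral>\<^sup>+ y. ?h j y \<partial>lborel) = ennreal ((R / 2 ^ Suc j) powr b) * ennreal (v * (R / 2 ^ j) ^ DIM('a))"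
      using R by (subst nn_integral_cmult) (auto simp: emeasure_cball v_def m_def intro!: borel_measurable_indicator)
    also have "\<dots> = ennreal ((R / 2 ^ Suc j) powr b * (v * (R / 2 ^ j) ^ DIM('a)))"
      by (simp add: ennreal_mult')
    also have "(R / 2 ^ Suc j) powr b * (v * (R / 2 ^ j) ^ DIM('a)) = C * q ^ j"
    proof -
      have "(R / 2 ^ j) ^ DIM('a) = R powr m * (2 powr - m) ^ j"
        using R by (simp add: powr_realpow[symmetric] powr_divide powr_powr m_def powr_minus field_simps)
      moreover have "(R / 2 ^ Suc j) powr b = (R / 2) powr b * (2 powr - b) ^ j"
        using R by (simp add: powr_realpow[symmetric] powr_divide powr_powr powr_minus powr_mult field_simps)
      moreover have "q ^ j = (2 powr - b) ^ j * (2 powr - m) ^ j"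
        by (simp add: q_def powr_add[symmetric] power_mult_distrib[symmetric])
      ultimately show ?thesis by (simp add: C_def)
    qed
    finally show ?thesis .
  qed
  have "(\<integral>\<^sup>+ y. ennreal (norm (indicat_real (cball 0 R) y *\<^sub>R norm (y::'a) powr b)) \<partial>lborel)
      \<le> (\<integral>\<^sup>+ y. (\<Sum>j. ?h j y) \<partial>lborel)"
    by (intro nn_integral_mono le)
  also have "\<dots> = (\<Sum>j. ennreal (C * q ^ j))"
    by (subst nn_integral_suminf) (measurable, simp only: h)
  also have "\<dots> = ennreal (\<Sum>j. C * q ^ j)"
    using C q by (intro suminf_ennreal2 summable_mult summable_geometric) auto
  also have "\<dots> < \<infinity>" by simp
  finally show ?thesis
    unfolding set_integrable_def by (intro integrableI_bounded) auto
next
  case False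
  then consider "b \<ge> 0" | "R \<le> 0" by linarith
  then show ?thesis
  proof cases
    case 1
    have "set_integrable lborel (cball 0 R) (\<lambda>y::'a. R powr b)"
      unfolding set_integrable_def
      by (intro integrable_real_mult_indicator integrableI_bounded_set_indicator[where B = "\<bar>R powr b\<bar>"])
         (use emeasure_bounded_finite[of "cball (0::'a) R"] in auto)
    then show ?thesis
      unfolding set_integrable_def
      by (rule Bochner_Integration.integrable_bound)
         (use 1 in \<open>auto simp: indicator_def intro!: powr_mono2\<close>)
  next
    case 2
    have "(\<lambda>y::'a. indicat_real (cball 0 R) y *\<^sub>R norm y powr b) = (\<lambda>_. 0)"
      using 2 by (auto simp: fun_eq_iff indicator_def intro: norm_le_zero_iff[THEN iffD1, OF order_trans])
    then show ?thesis unfolding set_integrable_def by simp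
  qed
qed

text \<open>Dividing by \<open>- b\<close> makes the sign uniform in \<open>b\<close> and makes the derivative \<open>- (r powr (b - 1))\<close> for every
  \<open>b\<close>, so that the logarithm is the case \<open>b = 0\<close> of one family and estimates are uniform near it.\<close>

definition riesz_kernel :: "real \<Rightarrow> real \<Rightarrow> real" where
  "riesz_kernel b r = (if b = 0 then - ln r else - (r powr b) / b)"

lemma riesz_kernel_measurable [measurable]: "riesz_kernel b \<in> borel_measurable borel"
  unfolding riesz_kernel_def[abs_def] by measurable

lemma riesz_kernel_integrable_cball:
  assumes "- real DIM('a::euclidean_space) < b"
  shows "set_integrable lborel (cball 0 R) (\<lambda>y::'a. riesz_kernel b (norm y))"
proof (cases "b = 0")
  case False
  then show ?thesis
    using set_integrable_mult_right[OF norm_powr_integrable_cball[OF assms, of R], of "- 1 / b"]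
    by (simp add: riesz_kernel_def set_integrable_def)
next
  case True
  \<comment> \<open>Near 0 and near infinity the logarithm is dominated by small powers, to which the previous lemma applies.\<close>
  have ln_le: "ln t \<le> 2 * t powr (1/2)" if "t > 0" for t :: real
    using ln_bound[of "t powr (1/2)"] that by (simp add: ln_powr)
  have le: "\<bar>ln r\<bar> \<le> 2 * r powr (1/2) + 2 * r powr (-1/2)" if "r > 0" for r :: real
    using ln_le[of r] ln_le[of "1/r"] that
    by (auto simp: ln_div powr_divide powr_minus_divide abs_if add_nonneg_nonneg add_increasing add_increasing2)
  have le': "\<bar>ln r\<bar> \<le> \<bar>2 * r powr (1/2) + 2 * r powr (-1/2)\<bar>" if "r \<ge> 0" for r :: real
    using le[of r] that by (cases "r = 0") auto
  have [measurable]: "cball (0::'a) r \<in> sets borel" for r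
    by (intro borel_closed closed_cball)
  have D: "1 < real DIM('a) * 2" using DIM_positive[where 'a='a] by linarith
  have "set_integrable lborel (cball 0 R) (\<lambda>y::'a. 2 * norm y powr (1/2) + 2 * norm y powr (-1/2))"
    using D by (intro set_integral_add set_integrable_mult_right norm_powr_integrable_cball) auto
  then show ?thesis
    unfolding set_integrable_def
  proof (rule Bochner_Integration.integrable_bound)
    show "AE y::'a in lborel. norm (indicat_real (cball 0 R) y *\<^sub>R riesz_kernel b (norm y))
        \<le> norm (indicat_real (cball 0 R) y *\<^sub>R (2 * norm y powr (1/2) + 2 * norm y powr (-1/2)))"
      using le'[of "norm y" for y :: 'a] by (intro AE_I2) (simp add: riesz_kernel_def True indicator_def)
  qed measurable
qed

section \<open>Continuity of the potential\<close>

definition riesz_potential :: "real \<Rightarrow> 'a::euclidean_space set \<Rightarrow> 'a \<Rightarrow> real" where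
  "riesz_potential b K x = (LINT y:K|lborel. riesz_kernel b (norm (x - y)))"

lemma riesz_kernel_integrable:
  fixes x :: "'a::euclidean_space"
  assumes b: "- real DIM('a) < b" and S: "bounded S" "S \<in> sets borel"
  shows "set_integrable lborel S (\<lambda>y. riesz_kernel b (norm (x - y)))"
proof -
  obtain R where R: "S \<subseteq> cball x R"
    using S(1) bounded_any_center[of S x] by (auto simp: subset_iff)
  have "integrable (distr lborel lborel (\<lambda>y. x - y))
      (\<lambda>z. indicat_real (cball 0 R) z *\<^sub>R riesz_kernel b (norm z))"
    using riesz_kernel_integrable_cball[OF b, of R] by (simp add: lborel_distr_minus set_integrable_def)
  then have "integrable lborel (\<lambda>y. indicat_real (cball 0 R) (x - y) *\<^sub>R riesz_kernel b (norm (x - y)))"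
    by (rule integrable_distr[rotated]) simp
  moreover have "indicat_real (cball 0 R) (x - y) = indicat_real (cball x R) y" for y
    by (simp add: indicator_def dist_norm norm_minus_commute)
  ultimately have "set_integrable lborel (cball x R) (\<lambda>y. riesz_kernel b (norm (x - y)))"
    by (simp add: set_integrable_def)
  then show ?thesis by (rule set_integrable_subset) (use S R in auto)
qed

text \<open>In this form the singularity of the kernel stays at the origin when \<open>x\<close> moves.\<close>

lemma riesz_potential_eq_convolution:
  fixes x :: "'a::euclidean_space"
  assumes [measurable]: "K \<in> sets borel"
  shows "riesz_potential b K x = (LINT z|lborel. indicat_real K (x - z) * riesz_kernel b (norm z))"
proof -
  have "riesz_potential b K x = (LINT y|distr lborel lborel (\<lambda>z. x - z). indicat_real K y * riesz_kernel b (norm (x - y)))"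
    by (simp add: riesz_potential_def set_lebesgue_integral_def lborel_distr_minus)
  also have "\<dots> = (LINT z|lborel. indicat_real K (x - z) * riesz_kernel b (norm z))"
    by (subst integral_distr) auto
  finally show ?thesis .
qed

text \<open>When \<open>x\<close> moves, only the indicator of the translated set changes, and it converges except at points
  carried to the boundary of \<open>K\<close>, which is a null set by convexity. Dominated convergence applies, with the
  absolute value of the kernel on a large ball as majorant.\<close>

lemma riesz_potential_continuous:
  fixes K :: "'a::euclidean_space set"
  assumes b: "- real DIM('a) < b" and K: "compact K" "convex K"
  shows "continuous_on UNIV (riesz_potential b K)"
proof (rule continuous_at_imp_continuous_on, rule ballI, unfold continuous_at_sequentially o_def, intro allI impI)
  fix x and u :: "nat \<Rightarrow> 'a"
  assume u: "u \<longlonglongrightarrow> x"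
  have [measurable]: "K \<in> sets borel" using K by (simp add: borel_compact)
  obtain B where B: "\<And>y. y \<in> K \<Longrightarrow> norm y \<le> B"
    using compact_imp_bounded[OF K(1)] by (auto simp: bounded_iff)
  obtain B' where B': "\<And>n. norm (u n) \<le> B'"
    using convergent_imp_Bseq[of u] u by (auto simp: convergent_def Bseq_def)
  define w where "w z = indicat_real (cball 0 (B + B')) z * \<bar>riesz_kernel b (norm z)\<bar>" for z :: 'a
  have w: "integrable lborel w"
    using set_integrable_abs[OF riesz_kernel_integrable_cball[OF b, of "B + B'"]]
    by (simp add: w_def[abs_def] set_integrable_def)
  have [measurable]: "frontier K \<in> sets borel" by (intro borel_closed frontier_closed)
  have fr: "frontier K \<in> null_sets lborel"
    using negligible_convex_frontier[OF K(2)]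
    by (simp add: negligible_iff_null_sets null_sets_completion_iff)
  have "AE z in distr lborel lborel (\<lambda>z. x - z). z \<notin> frontier K"
    unfolding lborel_distr_minus using fr by (rule AE_not_in)
  then have ae: "AE z in lborel. x - z \<notin> frontier K"
    by (subst (asm) AE_distr_iff) auto
  have "(\<lambda>n. LINT z|lborel. indicat_real K (u n - z) * riesz_kernel b (norm z))
      \<longlonglongrightarrow> (LINT z|lborel. indicat_real K (x - z) * riesz_kernel b (norm z))"
  proof (rule integral_dominated_convergence[where w = w])
    show "AE z in lborel. (\<lambda>n. indicat_real K (u n - z) * riesz_kernel b (norm z))
        \<longlonglongrightarrow> indicat_real K (x - z) * riesz_kernel b (norm z)"
      using ae
    proof eventually_elim
      case (elim z)
      have lim: "(\<lambda>n. u n - z) \<longlonglongrightarrow> x - z" by (intro tendsto_intros u)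
      have "eventually (\<lambda>n. indicat_real K (u n - z) = indicat_real K (x - z)) sequentially"
      proof (cases "x - z \<in> K")
        case True
        then have "x - z \<in> interior K" using elim by (simp add: frontier_def closure_def)
        then have "eventually (\<lambda>n. u n - z \<in> interior K) sequentially"
          using topological_tendstoD[OF lim] by blast
        then show ?thesis
          by eventually_elim (use True interior_subset[of K] in \<open>auto simp: indicator_def\<close>)
      next
        case False
        have "open (- K)" using K by (simp add: compact_imp_closed open_Compl)
        then have "eventually (\<lambda>n. u n - z \<in> - K) sequentially"
          using topological_tendstoD[OF lim] False by blast
        then show ?thesis
          by eventually_elim (use False in auto)
      qed
      then show ?case
        by (intro tendsto_eventually) (auto elim: eventually_mono)
    qed
    show "AE z in lborel. norm (indicat_real K (u n - z) * riesz_kernel b (norm z)) \<le> w z" for n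
    proof (rule AE_I2)
      fix z
      have "norm z \<le> B + B'" if "u n - z \<in> K"
        using norm_triangle_ineq4[of "u n" "u n - z"] B[OF that] B'[of n] by simp
      then show "norm (indicat_real K (u n - z) * riesz_kernel b (norm z)) \<le> w z"
        by (auto simp: w_def indicator_def abs_mult)
    qed
  qed (use w in auto)
  then show "(\<lambda>n. riesz_potential b K (u n)) \<longlonglongrightarrow> riesz_potential b K x"
    by (simp add: riesz_potential_eq_convolution)
qed

section \<open>Reflections in hyperplanes\<close>

text \<open>The hyperplane is \<open>{y. n \<bullet> y = s}\<close>; its normal vector \<open>n\<close> need not have length 1.\<close>

definition hyperplane_reflection :: "'a::euclidean_space \<Rightarrow> real \<Rightarrow> 'a \<Rightarrow> 'a" where
  "hyperplane_reflection n s y = y - (2 * (n \<bullet> y - s) / (n \<bullet> n)) *\<^sub>R n"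

lemma hyperplane_reflection_measurable [measurable]:
  "hyperplane_reflection n s \<in> borel_measurable borel"
  unfolding hyperplane_reflection_def[abs_def] by measurable

lemma inner_hyperplane_reflection:
  "n \<noteq> 0 \<Longrightarrow> n \<bullet> hyperplane_reflection n s y = 2 * s - n \<bullet> y"
  by (simp add: hyperplane_reflection_def inner_diff_right field_simps)

lemma hyperplane_reflection_involution:
  assumes "n \<noteq> 0"
  shows "hyperplane_reflection n s (hyperplane_reflection n s y) = y"
proof -
  have "2 * (n \<bullet> hyperplane_reflection n s y - s) / (n \<bullet> n) = - (2 * (n \<bullet> y - s) / (n \<bullet> n))"
    using assms by (simp add: inner_hyperplane_reflection field_simps)
  then have "hyperplane_reflection n s (hyperplane_reflection n s y)
      = hyperplane_reflection n s y + (2 * (n \<bullet> y - s) / (n \<bullet> n)) *\<^sub>R n"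
    by (subst hyperplane_reflection_def) simp
  then show ?thesis by (simp add: hyperplane_reflection_def)
qed

text \<open>The sign of the correction term says that a point beyond the hyperplane, seen from \<open>w\<close>, comes closer to \<open>w\<close>
  when it is reflected.\<close>

lemma hyperplane_reflection_dist_sq:
  assumes "n \<noteq> 0"
  shows "(norm (hyperplane_reflection n s y - w))\<^sup>2
       = (norm (y - w))\<^sup>2 - 4 * (n \<bullet> y - s) * (s - n \<bullet> w) / (n \<bullet> n)"
proof -
  define t where "t = 2 * (n \<bullet> y - s) / (n \<bullet> n)"
  have tn: "t * (n \<bullet> n) = 2 * (n \<bullet> y - s)" using assms by (simp add: t_def)
  have "(norm (hyperplane_reflection n s y - w))\<^sup>2 = (norm ((y - w) - t *\<^sub>R n))\<^sup>2"
    by (simp add: hyperplane_reflection_def t_def algebra_simps)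
  also have "\<dots> = (norm (y - w))\<^sup>2 - 2 * t * (n \<bullet> y - n \<bullet> w) + t * (t * (n \<bullet> n))"
    by (simp add: power2_norm_eq_inner inner_diff_left inner_diff_right inner_commute algebra_simps)
  also have "\<dots> = (norm (y - w))\<^sup>2 - 2 * t * (s - n \<bullet> w)"
    unfolding tn by (simp add: algebra_simps)
  finally show ?thesis by (simp add: t_def)
qed

lemma hyperplane_reflection_preserves_lborel:
  fixes n :: "'a::euclidean_space"
  assumes n: "n \<noteq> 0"
  shows "distr lborel lborel (hyperplane_reflection n s) = lborel"
proof -
  let ?R = "hyperplane_reflection n 0"
  have "linear ?R"
    by (intro linearI) (simp_all add: hyperplane_reflection_def inner_add_right algebra_simps add_divide_distrib)
  moreover have "norm (?R v) = norm v" for v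
    using hyperplane_reflection_dist_sq[OF n, of 0 v 0] by simp
  ultimately have "orthogonal_transformation ?R" by (simp add: orthogonal_transformation)
  then have R: "distr lborel lborel ?R = lborel" by (rule orthogonal_transformation_preserves_lborel)
  have "hyperplane_reflection n s = (\<lambda>z. (2 * s / (n \<bullet> n)) *\<^sub>R n + z) \<circ> ?R"
    by (auto simp: hyperplane_reflection_def fun_eq_iff algebra_simps diff_divide_distrib)
  then have "distr lborel lborel (hyperplane_reflection n s)
      = distr (distr lborel lborel ?R) lborel (\<lambda>z. (2 * s / (n \<bullet> n)) *\<^sub>R n + z)"
    by (subst distr_distr) auto
  then show ?thesis by (simp add: R lborel_distr_plus')
qed

section \<open>Parallel bodies\<close>

lemma mem_parallel_body_iff:
  assumes "\<delta> > 0"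
  shows "y \<in> parallel_body \<Omega> \<delta> \<longleftrightarrow> (\<exists>w\<in>\<Omega>. norm (y - w) \<le> \<delta>)"
proof
  assume "y \<in> parallel_body \<Omega> \<delta>"
  then show "\<exists>w\<in>\<Omega>. norm (y - w) \<le> \<delta>"
    using assms by (force simp: parallel_body_def)
next
  assume "\<exists>w\<in>\<Omega>. norm (y - w) \<le> \<delta>"
  then obtain w where "w \<in> \<Omega>" "norm (y - w) \<le> \<delta>" by auto
  then show "y \<in> parallel_body \<Omega> \<delta>"
    unfolding parallel_body_def using assms
    by (intro CollectI exI[of _ w] exI[of _ "(1 / \<delta>) *\<^sub>R (y - w)"]) auto
qed

lemma parallel_body_eq_sums:
  "parallel_body \<Omega> \<delta> = {x + y | x y. x \<in> \<Omega> \<and> y \<in> (\<lambda>u. \<delta> *\<^sub>R u) ` cball 0 1}"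
  unfolding parallel_body_def by blast

lemma compact_parallel_body: "compact \<Omega> \<Longrightarrow> compact (parallel_body \<Omega> \<delta>)"
  unfolding parallel_body_eq_sums by (intro compact_sums compact_scaling compact_cball)

lemma convex_parallel_body: "convex \<Omega> \<Longrightarrow> convex (parallel_body \<Omega> \<delta>)"
proof -
  assume "convex \<Omega>"
  then have "convex (\<Union>x\<in>\<Omega>. \<Union>y\<in>(\<lambda>u. \<delta> *\<^sub>R u) ` cball 0 1. {x + y})"
    by (intro convex_sums convex_scaling convex_cball)
  moreover have "(\<Union>x\<in>\<Omega>. \<Union>y\<in>(\<lambda>u. \<delta> *\<^sub>R u) ` cball 0 1. {x + y}) = parallel_body \<Omega> \<delta>"
    unfolding parallel_body_eq_sums by blast
  ultimately show ?thesis by simp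
qed

section \<open>Centers lie in the original convex set\<close>

lemma riesz_kernel_deriv:
  assumes "r > 0"
  shows "(riesz_kernel b has_real_derivative - (r powr (b - 1))) (at r)"
proof (cases "b = 0")
  case True
  have "((\<lambda>r. - ln r) has_real_derivative - (r powr (b - 1))) (at r)"
    using DERIV_minus[OF DERIV_ln_divide[OF assms]] assms by (simp add: True powr_minus_divide)
  then show ?thesis by (simp add: riesz_kernel_def[abs_def] True)
next
  case False
  have "((\<lambda>r. - (r powr b) / b) has_real_derivative - (r powr (b - 1))) (at r)"
    using DERIV_cdivide[OF DERIV_minus[OF has_real_derivative_powr[OF assms, of b]], of b] False by simp
  then show ?thesis using False by (simp add: riesz_kernel_def[abs_def])
qed

lemma riesz_kernel_strict_antimono:
  assumes "0 < r" "r < s"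
  shows "riesz_kernel b s < riesz_kernel b r"
proof (rule DERIV_neg_imp_decreasing[OF assms(2)])
  fix x assume "r \<le> x" "x \<le> s"
  then have "x > 0" using assms by linarith
  then show "\<exists>y. DERIV (riesz_kernel b) x :> y \<and> y < 0"
    using riesz_kernel_deriv[of x b] by (intro exI[of _ "- (x powr (b - 1))"]) simp
qed

lemma riesz_kernel_antimono:
  "0 < r \<Longrightarrow> r \<le> s \<Longrightarrow> riesz_kernel b s \<le> riesz_kernel b r"
  using riesz_kernel_strict_antimono[of r s b] by (cases "r = s") auto

text \<open>With \<open>\<sigma>\<close> the reflection exchanging \<open>x\<close> and its closest point \<open>z\<close>, and \<open>D\<close> the difference of the two
  integrands, \<open>D \<circ> \<sigma> = - D\<close>. Hence twice \<open>\<integral>\<^sub>K D\<close> is the integral of \<open>D y * (1\<^sub>K y - 1\<^sub>K (\<sigma> y))\<close>, whose two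
  factors have the same sign
  almost everywhere, because \<open>\<sigma>\<close> folds the \<open>x\<close>-side of \<open>K\<close> into \<open>K\<close>. The exceptions are
  \<open>x\<close> and \<open>z\<close>, where the kernel takes a default value.\<close>

lemma riesz_potential_less_closest_point:
  fixes \<Omega> :: "'a::euclidean_space set"
  assumes b: "- real DIM('a) < b"
    and \<Omega>: "\<Omega> \<noteq> {}" "compact \<Omega>" "convex \<Omega>" and \<delta>: "\<delta> > 0" and x: "x \<notin> \<Omega>"
  shows "riesz_potential b (parallel_body \<Omega> \<delta>) x
       < riesz_potential b (parallel_body \<Omega> \<delta>) (closest_point \<Omega> x)"
proof -
  define K where "K = parallel_body \<Omega> \<delta>"
  define z where "z = closest_point \<Omega> x"
  define n where "n = x - z"
  define s where "s = n \<bullet> z + n \<bullet> n / 2"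
  define \<sigma> where "\<sigma> = hyperplane_reflection n s"
  define D where "D y = riesz_kernel b (norm (z - y)) - riesz_kernel b (norm (x - y))" for y
  define F where "F y = D y * (indicat_real K y - indicat_real K (\<sigma> y))" for y
  have K: "compact K" using \<Omega> by (simp add: K_def compact_parallel_body)
  then have [measurable]: "K \<in> sets borel" by (rule borel_compact)
  have Kiff: "y \<in> K \<longleftrightarrow> (\<exists>w\<in>\<Omega>. norm (y - w) \<le> \<delta>)" for y
    by (simp add: K_def mem_parallel_body_iff[OF \<delta>])
  have closed: "closed \<Omega>" using \<Omega> by (simp add: compact_imp_closed)
  have z: "z \<in> \<Omega>" using closest_point_in_set[OF closed \<Omega>(1)] by (simp add: z_def)
  have n: "n \<noteq> 0" using z x by (auto simp: n_def)
  have nn: "n \<bullet> n > 0" using n by simp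
  have side: "n \<bullet> w \<le> n \<bullet> z" if "w \<in> \<Omega>" for w
    using closest_point_dot[OF \<Omega>(3) closed that, of x] by (simp add: n_def z_def inner_diff_right)
  have side': "n \<bullet> w < s" if "w \<in> \<Omega>" for w
    using side[OF that] nn unfolding s_def by linarith
  have [measurable]: "\<sigma> \<in> borel_measurable borel" by (simp add: \<sigma>_def)
  have inv: "\<sigma> (\<sigma> y) = y" for y by (simp add: \<sigma>_def hyperplane_reflection_involution n)
  have n\<sigma>: "n \<bullet> \<sigma> y = 2 * s - n \<bullet> y" for y by (simp add: \<sigma>_def inner_hyperplane_reflection n)
  have dsq: "(norm (\<sigma> y - w))\<^sup>2 = (norm (y - w))\<^sup>2 - 4 * (n \<bullet> y - s) * (s - n \<bullet> w) / (n \<bullet> n)" for y w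
    by (simp add: \<sigma>_def hyperplane_reflection_dist_sq n)
  have halves: "(norm (x - y))\<^sup>2 = (norm (z - y))\<^sup>2 - 2 * (n \<bullet> y - s)" for y
    by (simp add: n_def s_def power2_norm_eq_inner inner_diff_left inner_diff_right inner_commute field_simps)
  have swap: "norm (x - \<sigma> y) = norm (z - y)" for y
  proof -
    have "(norm (x - \<sigma> y))\<^sup>2 = (norm (z - y))\<^sup>2"
      using dsq[of y z] nn unfolding halves[of "\<sigma> y"] n\<sigma> norm_minus_commute[of z]
      by (simp add: s_def)
    then show ?thesis by simp
  qed
  have swap': "norm (z - \<sigma> y) = norm (x - y)" for y using swap[of "\<sigma> y"] by (simp add: inv)
  have D\<sigma>: "D (\<sigma> y) = - D y" for y by (simp add: D_def swap swap')
  have far: "norm (x - y) \<le> norm (z - y) \<longleftrightarrow> s \<le> n \<bullet> y"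
    "norm (z - y) < norm (x - y) \<longleftrightarrow> n \<bullet> y < s" for y
  proof -
    have "norm (x - y) \<le> norm (z - y) \<longleftrightarrow> (norm (x - y))\<^sup>2 \<le> (norm (z - y))\<^sup>2"
      by (simp add: power_mono_iff)
    then show 1: "norm (x - y) \<le> norm (z - y) \<longleftrightarrow> s \<le> n \<bullet> y"
      unfolding halves by simp
    then show "norm (z - y) < norm (x - y) \<longleftrightarrow> n \<bullet> y < s" by linarith
  qed
  have fold: "\<sigma> y \<in> K" if "y \<in> K" "s \<le> n \<bullet> y" for y
  proof -
    from that obtain w where w: "w \<in> \<Omega>" "norm (y - w) \<le> \<delta>" by (auto simp: Kiff)
    have "(norm (\<sigma> y - w))\<^sup>2 \<le> (norm (y - w))\<^sup>2"
      unfolding dsq using that(2) side'[OF w(1)] nn by simp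
    then have "norm (\<sigma> y - w) \<le> norm (y - w)" by simp
    then show ?thesis using w Kiff by force
  qed
  have D_pos: "D y > 0" if "n \<bullet> y < s" "y \<noteq> z" for y
    using that far[of y] by (auto simp: D_def intro!: riesz_kernel_strict_antimono)
  have D_neg: "D y \<le> 0" if "s \<le> n \<bullet> y" "y \<noteq> x" for y
    using that far[of y] by (auto simp: D_def intro!: riesz_kernel_antimono)
  have F_nonneg: "F y \<ge> 0" if "y \<noteq> x" "y \<noteq> z" for y
  proof (cases "s \<le> n \<bullet> y")
    case True
    then show ?thesis using D_neg[OF True that(1)] fold[of y]
      by (auto simp: F_def indicator_def)
  next
    case False
    then have "\<sigma> y \<in> K \<Longrightarrow> y \<in> K" using fold[of "\<sigma> y"] by (simp add: inv n\<sigma>)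
    then show ?thesis using D_pos[of y] False that
      by (auto simp: F_def indicator_def)
  qed
  \<comment> \<open>An open set of points of \<open>K\<close> on the \<open>z\<close>-side whose mirror images miss \<open>K\<close>; it makes the inequality strict.\<close>
  define U where "U = interior K \<inter> (\<sigma> -` (- K)) \<inter> {y. n \<bullet> y < s} - {z}"
  have F_pos: "F y > 0" if "y \<in> U" for y
    using that D_pos[of y] interior_subset[of K] by (auto simp: U_def F_def indicator_def)
  have "continuous_on UNIV \<sigma>"
    unfolding \<sigma>_def hyperplane_reflection_def[abs_def] by (intro continuous_intros) (use n in auto)
  then have openU: "open U"
    unfolding U_def using K
    by (intro open_Int open_Diff open_interior open_vimage open_halfspace_lt closed_singleton)
      (auto intro: compact_imp_closed)
  have neU: "U \<noteq> {}"
  proof -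
    \<comment> \<open>A point of the ball about \<open>z\<close>, just inside its far side; its mirror image lies at distance
      more than \<open>\<delta>\<close> beyond the supporting hyperplane of \<open>\<Omega>\<close> at \<open>z\<close>. The choice of \<open>\<eta>\<close> also keeps it away from \<open>z\<close>.\<close>
    define \<eta> where "\<eta> = min \<delta> (norm n) / 2"
    have \<eta>: "0 < \<eta>" "\<eta> < \<delta>" "\<eta> < norm n" using \<delta> n by (auto simp: \<eta>_def min_def field_simps)
    define y where "y = z - ((\<delta> - \<eta>) / norm n) *\<^sub>R n"
    have ny: "n \<bullet> y = n \<bullet> z - (\<delta> - \<eta>) * norm n"
      using n by (simp add: y_def inner_diff_right power2_norm_eq_inner[symmetric] power2_eq_square)
    have "y \<in> ball z \<delta>" using \<eta> n by (simp add: y_def dist_norm)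
    moreover have "ball z \<delta> \<subseteq> K" using z by (auto simp: Kiff dist_norm norm_minus_commute intro!: bexI[of _ z])
    ultimately have "y \<in> interior K" using interior_maximal[OF _ open_ball] by blast
    moreover have "\<sigma> y \<notin> K"
    proof
      assume "\<sigma> y \<in> K"
      then obtain w where w: "w \<in> \<Omega>" "norm (\<sigma> y - w) \<le> \<delta>" by (auto simp: Kiff)
      have "norm n * norm n + (\<delta> - \<eta>) * norm n \<le> n \<bullet> (\<sigma> y - w)"
        using side[OF w(1)] by (simp add: inner_diff_right n\<sigma> ny s_def power2_norm_eq_inner[symmetric] power2_eq_square)
      also have "\<dots> \<le> norm n * \<delta>"
        using w(2) norm_cauchy_schwarz[of n "\<sigma> y - w"] by (meson mult_left_mono norm_ge_zero order_trans)
      finally have "norm n * (norm n - \<eta>) \<le> 0" by (simp add: algebra_simps)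
      then show False using \<eta> n by (simp add: mult_le_0_iff)
    qed
    moreover have "n \<bullet> y < s"
      using ny nn mult_nonneg_nonneg[of "\<delta> - \<eta>" "norm n"] \<eta> norm_ge_zero[of n] unfolding s_def by linarith
    moreover have "y \<noteq> z" using \<eta> n by (simp add: y_def)
    ultimately show ?thesis by (auto simp: U_def)
  qed
  have intDK: "integrable lborel (\<lambda>y. D y * indicat_real K y)"
    using set_integral_diff(1)[OF riesz_kernel_integrable[OF b compact_imp_bounded[OF K], of z]
        riesz_kernel_integrable[OF b compact_imp_bounded[OF K], of x]]
    by (simp add: set_integrable_def D_def mult.commute)
  have [measurable]: "D \<in> borel_measurable borel" unfolding D_def[abs_def] by measurable
  have dist\<sigma>: "distr lborel lborel \<sigma> = lborel" by (simp add: \<sigma>_def hyperplane_reflection_preserves_lborel n)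
  have int2: "integrable lborel (\<lambda>y. D (\<sigma> y) * indicat_real K (\<sigma> y))"
    using intDK by (subst (asm) dist\<sigma>[symmetric]) (auto dest: integrable_distr[rotated])
  have eq2: "(LINT y|lborel. D (\<sigma> y) * indicat_real K (\<sigma> y)) = (LINT y|lborel. D y * indicat_real K y)"
    using integral_distr[of \<sigma> lborel lborel "\<lambda>y. D y * indicat_real K y"] by (simp add: dist\<sigma>)
  have Feq: "F = (\<lambda>y. D y * indicat_real K y + D (\<sigma> y) * indicat_real K (\<sigma> y))"
    by (auto simp: F_def fun_eq_iff D\<sigma> algebra_simps)
  have intF: "integrable lborel F" unfolding Feq by (intro Bochner_Integration.integrable_add intDK int2)
  have "LINT y|lborel. F y = 2 * (LINT y|lborel. D y * indicat_real K y)"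
    unfolding Feq by (subst Bochner_Integration.integral_add[OF intDK int2]) (simp add: eq2)
  moreover have "(LINT y|lborel. D y * indicat_real K y) = riesz_potential b K z - riesz_potential b K x"
    unfolding riesz_potential_def
    by (subst set_integral_diff(2)[symmetric])
       (auto intro!: riesz_kernel_integrable b compact_imp_bounded K simp: set_lebesgue_integral_def D_def mult.commute)
  moreover have "(LINT y|lborel. F y) > 0"
  proof -
    have ae: "AE y in lborel. F y \<ge> 0"
      using AE_lborel_singleton[of x] AE_lborel_singleton[of z] by eventually_elim (rule F_nonneg)
    have "(LINT y|lborel. F y) \<noteq> 0"
    proof
      assume "(LINT y|lborel. F y) = 0"
      then have "AE y in lborel. F y = 0"
        using integral_nonneg_eq_0_iff_AE[OF intF ae] by simp
      then have "AE y in lborel. y \<notin> U" by eventually_elim (use F_pos in force)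
      then have "U \<in> null_sets lborel" using openU by (subst (asm) AE_iff_null) auto
      then have "negligible U"
        by (simp add: negligible_iff_null_sets null_sets_completionI)
      then show False using open_not_negligible[OF openU neU] by simp
    qed
    then show ?thesis using integral_nonneg_AE[OF ae] by linarith
  qed
  ultimately show ?thesis by (simp add: K_def z_def)
qed

section \<open>Second differences of the kernel\<close>

definition second_difference :: "real \<Rightarrow> 'a::real_normed_vector \<Rightarrow> 'a \<Rightarrow> real" where
  "second_difference b h u =
     riesz_kernel b (norm (u + h)) + riesz_kernel b (norm (u - h)) - 2 * riesz_kernel b (norm u)"

lemma second_difference_integral:
  fixes z :: "'a::euclidean_space"
  assumes b: "- real DIM('a) < b" and S: "bounded S" "S \<in> sets borel"
  shows "set_integrable lborel S (\<lambda>y. second_difference b h (z - y))"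
    and "(LINT y:S|lborel. second_difference b h (z - y))
       = riesz_potential b S (z + h) + riesz_potential b S (z - h) - 2 * riesz_potential b S z"
proof -
  note int = riesz_kernel_integrable[OF b S]
  have eq: "second_difference b h (z - y) = riesz_kernel b (norm (z + h - y))
      + riesz_kernel b (norm (z - h - y)) - 2 * riesz_kernel b (norm (z - y))" for y
    by (simp add: second_difference_def algebra_simps)
  show "set_integrable lborel S (\<lambda>y. second_difference b h (z - y))"
    unfolding eq by (intro set_integral_diff set_integral_add set_integrable_mult_right int)
  show "(LINT y:S|lborel. second_difference b h (z - y))
       = riesz_potential b S (z + h) + riesz_potential b S (z - h) - 2 * riesz_potential b S z"
    unfolding eq riesz_potential_def
    by (simp add: int set_integral_diff(2) set_integral_add set_integrable_mult_right)
qed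

text \<open>The estimates below treat the kernel as a function of the squared distance, because the squared distances
  from \<open>u\<close> to \<open>h\<close> and to \<open>- h\<close> have an average that does not depend on the direction of \<open>h\<close>.\<close>

lemma parallelogram_squares:
  fixes u h :: "'a::real_inner"
  shows "((norm (u + h))\<^sup>2 + (norm (u - h))\<^sup>2) / 2 = (norm u)\<^sup>2 + (norm h)\<^sup>2"
    and "((norm (u + h))\<^sup>2 - (norm (u - h))\<^sup>2)\<^sup>2 \<le> 16 * (norm u)\<^sup>2 * (norm h)\<^sup>2"
proof -
  show "((norm (u + h))\<^sup>2 + (norm (u - h))\<^sup>2) / 2 = (norm u)\<^sup>2 + (norm h)\<^sup>2"
    by (simp add: power2_norm_eq_inner inner_add_left inner_add_right inner_diff_left inner_diff_right)
  have "((norm (u + h))\<^sup>2 - (norm (u - h))\<^sup>2)\<^sup>2 = 16 * (u \<bullet> h)\<^sup>2"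
  proof -
    have "(norm (u + h))\<^sup>2 - (norm (u - h))\<^sup>2 = 4 * (u \<bullet> h)"
      by (simp add: power2_norm_eq_inner inner_add_left inner_add_right inner_diff_left inner_diff_right
          inner_commute)
    then show ?thesis by (simp add: power_mult_distrib)
  qed
  also have "\<dots> \<le> 16 * ((u \<bullet> u) * (h \<bullet> h))"
    using Cauchy_Schwarz_ineq[of u h] by simp
  finally show "((norm (u + h))\<^sup>2 - (norm (u - h))\<^sup>2)\<^sup>2 \<le> 16 * (norm u)\<^sup>2 * (norm h)\<^sup>2"
    by (simp add: power2_norm_eq_inner)
qed

lemma convex_on_midpoint:
  fixes f :: "real \<Rightarrow> real"
  assumes "convex_on A f" "x \<in> A" "y \<in> A"
  shows "2 * f ((x + y) / 2) \<le> f x + f y"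
  using convex_onD[OF assms(1), of "1/2" x y] assms(2,3) by (simp add: field_simps)

text \<open>Midpoint convexity of \<open>s powr (b / 2)\<close>, applied to \<open>s = \<bar>u \<plusminus> h\<bar>\<^sup>2\<close>, whose average exceeds \<open>\<bar>u\<bar>\<^sup>2\<close>. The two
  excluded values of \<open>u\<close> are those where a squared distance leaves the open half-line of \<open>powr_convex\<close>.\<close>

lemma second_difference_neg:
  fixes u h :: "'a::real_inner"
  assumes b: "2 \<le> b" and h: "h \<noteq> 0" and u: "u + h \<noteq> 0" "u - h \<noteq> 0"
  shows "second_difference b h u < 0"
proof -
  have k: "riesz_kernel b r = - ((r\<^sup>2) powr (b / 2)) / b" if "r \<ge> 0" for r
  proof (cases "r = 0")
    case False
    then have "(r\<^sup>2) powr (b / 2) = r powr b"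
      using that powr_powr[of r 2 "b/2"] by (simp add: powr_numeral)
    then show ?thesis using b by (simp add: riesz_kernel_def)
  qed (use b in \<open>simp add: riesz_kernel_def\<close>)
  have "2 * ((norm u)\<^sup>2) powr (b / 2) < 2 * ((norm u)\<^sup>2 + (norm h)\<^sup>2) powr (b / 2)"
    using b h by (intro mult_strict_left_mono powr_less_mono2) auto
  also have "\<dots> \<le> ((norm (u + h))\<^sup>2) powr (b / 2) + ((norm (u - h))\<^sup>2) powr (b / 2)"
    using convex_on_midpoint[OF powr_convex[of "b/2"], of "(norm (u + h))\<^sup>2" "(norm (u - h))\<^sup>2"] b u
    by (simp add: parallelogram_squares)
  finally show ?thesis
    using b by (simp add: second_difference_def k field_simps)
qed

lemma riesz_kernel_sqrt_deriv:
  assumes "s > 0"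
  shows "((\<lambda>s. riesz_kernel b (sqrt s)) has_real_derivative - (s powr (b / 2 - 1)) / 2) (at s)"
proof -
  have "((\<lambda>s. riesz_kernel b (sqrt s)) has_real_derivative
      - (sqrt s powr (b - 1)) * (inverse (sqrt s) / 2)) (at s)"
    using assms by (intro DERIV_chain2[OF riesz_kernel_deriv] DERIV_real_sqrt) auto
  also have "- (sqrt s powr (b - 1)) * (inverse (sqrt s) / 2) = - (s powr (b / 2 - 1)) / 2"
  proof -
    have "inverse (sqrt s) = s powr (- (1/2))"
      using assms by (simp add: powr_minus powr_half_sqrt)
    moreover have "sqrt s powr (b - 1) = s powr (1 / 2 * (b - 1))"
      using assms by (simp only: powr_half_sqrt[symmetric] less_imp_le powr_powr)
    ultimately have "sqrt s powr (b - 1) * inverse (sqrt s) = s powr (1 / 2 * (b - 1) + - (1/2))"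
      by (simp only: powr_add)
    also have "1 / 2 * (b - 1) + - (1/2) = b / 2 - 1" by (simp add: field_simps)
    finally show ?thesis by simp
  qed
  finally show ?thesis .
qed

text \<open>As a function of the squared distance \<open>s\<close> the kernel has second derivative at most \<open>M\<close> at distance
  at least \<open>\<delta> / 2\<close> from the origin, so subtracting it from \<open>M s\<^sup>2 / 2\<close> leaves a convex function. Its midpoint convexity at
  \<open>\<bar>u \<plusminus> h\<bar>\<^sup>2\<close> bounds the second difference; replacing the average \<open>\<bar>u\<bar>\<^sup>2 + \<bar>h\<bar>\<^sup>2\<close> by \<open>\<bar>u\<bar>\<^sup>2\<close> only helps, as the
  kernel decreases.\<close>

lemma second_difference_le_quadratic:
  fixes u h :: "'a::real_inner"
  assumes b: "b \<le> 2" "- m < b" and \<delta>: "\<delta> > 0"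
    and h: "norm h \<le> \<delta> / 2" and u: "\<delta> \<le> norm u" "norm u \<le> 2 * \<delta>"
  shows "second_difference b h u \<le> 64 * (m + 2) * 2 powr m * \<delta> powr (b - 2) * (norm h)\<^sup>2"
proof -
  define M where "M = (2 - b) / 4 * ((\<delta> / 2)\<^sup>2) powr (b / 2 - 2)"
  have M0: "M \<ge> 0" using b by (simp add: M_def)
  define H where "H s = M * s\<^sup>2 / 2 - riesz_kernel b (sqrt s)" for s
  have convex: "convex_on {(\<delta> / 2)\<^sup>2..} H"
  proof (rule f''_ge0_imp_convex)
    fix s assume "s \<in> {(\<delta> / 2)\<^sup>2..}"
    then have s: "(\<delta> / 2)\<^sup>2 \<le> s" "s > 0"
      using \<delta> by (auto intro: less_le_trans[of 0 "(\<delta> / 2)\<^sup>2"] simp del: power_divide)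
    show "(H has_real_derivative M * s + s powr (b / 2 - 1) / 2) (at s)"
      unfolding H_def[abs_def] by (auto intro!: derivative_eq_intros riesz_kernel_sqrt_deriv[OF s(2)])
    show "((\<lambda>s. M * s + s powr (b / 2 - 1) / 2) has_real_derivative
        M - (2 - b) / 4 * s powr (b / 2 - 2)) (at s)"
      using s by (auto intro!: derivative_eq_intros simp: field_simps)
    have "s powr (b / 2 - 2) \<le> ((\<delta> / 2)\<^sup>2) powr (b / 2 - 2)"
      using s b \<delta> by (intro powr_mono2') auto
    then show "0 \<le> M - (2 - b) / 4 * s powr (b / 2 - 2)"
      unfolding M_def using b by (simp add: mult_left_mono)
  qed (rule convex_real_interval)
  have ge: "\<delta> / 2 \<le> norm (u + h)" "\<delta> / 2 \<le> norm (u - h)"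
    using h u norm_triangle_ineq2[of u h] norm_diff_ineq[of u h] by linarith+
  let ?p = "(norm (u + h))\<^sup>2" and ?q = "(norm (u - h))\<^sup>2"
  have "2 * H ((?p + ?q) / 2) \<le> H ?p + H ?q"
    using ge \<delta> by (intro convex_on_midpoint[OF convex]) (auto intro!: power_mono simp del: power_divide)
  then have "riesz_kernel b (norm (u + h)) + riesz_kernel b (norm (u - h))
      \<le> 2 * riesz_kernel b (sqrt ((?p + ?q) / 2)) + M * (?p - ?q)\<^sup>2 / 4"
    by (simp add: H_def power2_eq_square field_simps)
  also have "riesz_kernel b (sqrt ((?p + ?q) / 2)) \<le> riesz_kernel b (norm u)"
  proof (rule riesz_kernel_antimono)
    show "0 < norm u" using u \<delta> by linarith
    show "norm u \<le> sqrt ((?p + ?q) / 2)"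
      unfolding parallelogram_squares by (intro real_le_rsqrt) simp
  qed
  also have "M * (?p - ?q)\<^sup>2 / 4 \<le> M * (16 * (2 * \<delta>)\<^sup>2 * (norm h)\<^sup>2) / 4"
  proof -
    have "(norm u)\<^sup>2 \<le> (2 * \<delta>)\<^sup>2" using u by (intro power_mono) auto
    then have "16 * (norm u)\<^sup>2 * (norm h)\<^sup>2 \<le> 16 * (2 * \<delta>)\<^sup>2 * (norm h)\<^sup>2"
      by (intro mult_right_mono) auto
    then have "(?p - ?q)\<^sup>2 \<le> 16 * (2 * \<delta>)\<^sup>2 * (norm h)\<^sup>2"
      using parallelogram_squares(2)[of u h] by linarith
    then show ?thesis using M0 by (intro divide_right_mono mult_left_mono) auto
  qed
  finally have "second_difference b h u \<le> 16 * M * \<delta>\<^sup>2 * (norm h)\<^sup>2"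
    by (simp add: second_difference_def power_mult_distrib)
  also have "16 * M * \<delta>\<^sup>2 \<le> 64 * (m + 2) * 2 powr m * \<delta> powr (b - 2)"
  proof -
    have sq: "((\<delta> / 2)\<^sup>2) powr (b / 2 - 2) = (\<delta> / 2) powr (b - 4)"
      using \<delta> powr_powr[of "\<delta>/2" 2 "b/2 - 2"] by (simp add: powr_numeral algebra_simps)
    have "(\<delta> / 2) powr (b - 4) * \<delta>\<^sup>2 = 2 powr (4 - b) * \<delta> powr (b - 2)"
    proof -
      have "(\<delta> / 2) powr (b - 4) * \<delta>\<^sup>2 = \<delta> powr (b - 4) * \<delta> powr 2 / 2 powr (b - 4)"
        using \<delta> by (simp add: powr_divide powr_numeral)
      also have "\<dots> = \<delta> powr (b - 2) * 2 powr (- (b - 4))"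
        using powr_minus_divide[of 2 "b - 4"] by (simp flip: powr_add)
      finally show ?thesis by simp
    qed
    moreover have "16 * M * \<delta>\<^sup>2 = 4 * (2 - b) * ((\<delta> / 2) powr (b - 4) * \<delta>\<^sup>2)"
      unfolding M_def sq by (simp add: field_simps)
    ultimately have "16 * M * \<delta>\<^sup>2 = 4 * (2 - b) * (2 powr (4 - b) * \<delta> powr (b - 2))"
      by simp
    also have "\<dots> \<le> 4 * (m + 2) * (2 powr (4 + m) * \<delta> powr (b - 2))"
      using b by (intro mult_mono[of "4 * (2 - b)"] mult_right_mono powr_mono) auto
    also have "\<dots> = 64 * (m + 2) * 2 powr m * \<delta> powr (b - 2)"
      by (simp add: powr_add powr_numeral)
    finally show ?thesis .
  qed
  finally show ?thesis by (simp add: mult_right_mono)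
qed

section \<open>The potential of a ball near its centre\<close>

text \<open>Since \<open>A\<close> and \<open>B\<close> have the same measure, \<open>f\<close> may be replaced by \<open>f - c\<close>, and then
  \<open>1\<^sub>A * (f - c) \<le> 1\<^sub>B * (f - c)\<close> almost everywhere.\<close>

lemma integral_le_by_rearrangement:
  fixes f :: "'a::euclidean_space \<Rightarrow> real"
  assumes A: "A \<in> lmeasurable" "A \<in> sets borel" and B: "B \<in> lmeasurable" "B \<in> sets borel"
    and eq: "measure lborel A = measure lborel B"
    and int: "set_integrable lborel A f" "set_integrable lborel B f"
    and out: "\<And>w. w \<in> A \<Longrightarrow> w \<notin> B \<Longrightarrow> f w \<le> c"
    and ins: "AE w in lborel. w \<in> B \<longrightarrow> c \<le> f w"
  shows "(LINT w:A|lborel. f w) \<le> (LINT w:B|lborel. f w)"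
proof -
  have finA: "set_integrable lborel A (\<lambda>_. c)" and finB: "set_integrable lborel B (\<lambda>_. c)"
    using A B by (auto simp: set_integrable_def fmeasurable_def)
  have "0 \<le> (LINT w|lborel. indicat_real B w *\<^sub>R (f w - c) - indicat_real A w *\<^sub>R (f w - c))"
    by (rule integral_nonneg_AE, use ins in eventually_elim) (use out in \<open>auto simp: indicator_def\<close>)
  also have "\<dots> = (LINT w:B|lborel. f w - c) - (LINT w:A|lborel. f w - c)"
    using set_integral_diff(1)[OF int(1) finA] set_integral_diff(1)[OF int(2) finB]
    unfolding set_lebesgue_integral_def set_integrable_def
    by (intro Bochner_Integration.integral_diff)
  also have "\<dots> = (LINT w:B|lborel. f w) - (LINT w:A|lborel. f w)"
    using eq A B by (simp add: set_integral_diff int finA finB set_lebesgue_integral_def[of _ _ "\<lambda>_. c"])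
  finally show ?thesis by simp
qed

text \<open>The kernel with exponent 2 is \<open>- r\<^sup>2 / 2\<close>, so its second difference is constant by the parallelogram law.\<close>

lemma riesz_potential_two_cball:
  fixes z :: "'a::euclidean_space"
  shows "riesz_potential 2 (cball z \<delta>) (z + h) + riesz_potential 2 (cball z \<delta>) (z - h)
       - 2 * riesz_potential 2 (cball z \<delta>) z = - (norm h)\<^sup>2 * measure lborel (cball z \<delta>)"
proof -
  have k: "riesz_kernel 2 r = - (r\<^sup>2) / 2" if "r \<ge> 0" for r
    using that by (cases "r = 0") (auto simp: riesz_kernel_def powr_numeral)
  have "second_difference 2 h u = - (norm h)\<^sup>2" for u :: 'a
    using parallelogram_squares(1)[of u h] by (simp add: second_difference_def k field_simps)
  then have "(LINT y:cball z \<delta>|lborel. - (norm h)\<^sup>2) = riesz_potential 2 (cball z \<delta>) (z + h)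
      + riesz_potential 2 (cball z \<delta>) (z - h) - 2 * riesz_potential 2 (cball z \<delta>) z"
    using second_difference_integral(2)[where b = 2 and S = "cball z \<delta>" and z = z and h = h]
      DIM_positive[where 'a = 'a] by simp
  moreover have "(LINT y:cball z \<delta>|lborel. - (norm h)\<^sup>2) = - (norm h)\<^sup>2 * measure lborel (cball z \<delta>)"
    by (simp add: set_lebesgue_integral_def)
  ultimately show ?thesis by simp
qed

text \<open>The derivative in \<open>r\<close> is \<open>- (r powr (b - 1)) + \<kappa> r\<close>, so the claim is \<open>\<kappa> \<le> r powr (b - 2)\<close>. The right-hand side is
  smallest at \<open>r = 2 \<delta>\<close>, and \<open>\<kappa>\<close> is that value with the power of 2 replaced by its lower bound \<open>2 powr (- m - 2)\<close>.\<close>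

lemma riesz_kernel_minus_quadratic_antimono:
  assumes b: "b \<le> 2" "- m < b" and \<delta>: "\<delta> > 0" and r: "0 < r" "r \<le> s" "s \<le> 2 * \<delta>"
    and \<kappa>: "\<kappa> = 2 powr (- m - 2) * \<delta> powr (b - 2)"
  shows "riesz_kernel b s - \<kappa> * riesz_kernel 2 s \<le> riesz_kernel b r - \<kappa> * riesz_kernel 2 r"
proof (rule DERIV_nonpos_imp_nonincreasing[OF r(2)])
  fix t assume t: "r \<le> t" "t \<le> s"
  then have t0: "t > 0" using r by linarith
  have "((\<lambda>r. riesz_kernel b r - \<kappa> * riesz_kernel 2 r) has_real_derivative
      - (t powr (b - 1)) - \<kappa> * - (t powr (2 - 1))) (at t)"
    using t0 by (intro DERIV_diff DERIV_cmult riesz_kernel_deriv)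
  moreover have "- (t powr (b - 1)) - \<kappa> * - (t powr (2 - 1)) \<le> 0"
  proof -
    have "\<kappa> \<le> 2 powr (b - 2) * \<delta> powr (b - 2)"
      unfolding \<kappa> using b by (intro mult_right_mono powr_mono) auto
    also have "\<dots> = (2 * \<delta>) powr (b - 2)" using \<delta> by (simp add: powr_mult)
    also have "\<dots> \<le> t powr (b - 2)" using t t0 r b by (intro powr_mono2') auto
    finally have "\<kappa> * t \<le> t powr (b - 2) * t" using t0 by simp
    also have "\<dots> = t powr (b - 1)"
      using t0 powr_add[of t "b - 2" 1] by simp
    finally show ?thesis using t0 by simp
  qed
  ultimately show "\<exists>y. DERIV (\<lambda>r. riesz_kernel b r - \<kappa> * riesz_kernel 2 r) t :> y \<and> y \<le> 0" by blast
qed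

text \<open>The function \<open>k\<^sub>b - \<kappa> k\<^sub>2\<close> is radially decreasing on the ball of radius \<open>2 \<delta>\<close>, which contains every translate
  that occurs, so its integral over a ball of radius \<open>\<delta>\<close> is largest when the ball is centred. Thus the
  second difference for \<open>k\<^sub>b\<close> is at most \<open>\<kappa>\<close> times the explicit one for \<open>k\<^sub>2\<close>.\<close>

lemma riesz_potential_cball_centre_drop:
  fixes z :: "'a::euclidean_space"
  assumes b: "b \<le> 2" "- real DIM('a) < b" and \<delta>: "\<delta> > 0" and h: "norm h \<le> \<delta>"
  defines "\<kappa> \<equiv> 2 powr (- real DIM('a) - 2) * \<delta> powr (b - 2)"
  shows "riesz_potential b (cball z \<delta>) (z + h) + riesz_potential b (cball z \<delta>) (z - h)
       - 2 * riesz_potential b (cball z \<delta>) z \<le> - \<kappa> * (norm h)\<^sup>2 * measure lborel (cball z \<delta>)"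
proof -
  define f where "f w = riesz_kernel b (norm w) - \<kappa> * riesz_kernel 2 (norm w)" for w :: 'a
  define c where "c = riesz_kernel b \<delta> - \<kappa> * riesz_kernel 2 \<delta>"
  have two: "- real DIM('a) < 2" by linarith
  have [measurable]: "cball w r \<in> sets borel" for w :: 'a and r by (intro borel_closed closed_cball)
  have int: "set_integrable lborel S f" if "bounded S" "S \<in> sets borel" for S
    using set_integral_diff(1)[OF riesz_kernel_integrable[OF b(2) that, of 0]
        set_integrable_mult_right[OF riesz_kernel_integrable[OF two that, of 0]], of \<kappa>]
    by (simp add: f_def[abs_def])
  have pot: "riesz_potential b (cball z \<delta>) (z + g) - \<kappa> * riesz_potential 2 (cball z \<delta>) (z + g)
      = (LINT w:cball g \<delta>|lborel. f w)" for g
  proof -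
    have shift: "riesz_potential a (cball z \<delta>) (z + g)
        = (LINT w:cball g \<delta>|lborel. riesz_kernel a (norm w))" for a
    proof -
      have "indicat_real (cball z \<delta>) (z + g - w) = indicat_real (cball g \<delta>) w" for w
        by (simp add: indicator_def dist_norm norm_minus_commute algebra_simps)
      then show ?thesis
        by (simp add: riesz_potential_eq_convolution set_lebesgue_integral_def)
    qed
    have "set_integrable lborel (cball g \<delta>) (\<lambda>w. riesz_kernel a (norm w))" if "- real DIM('a) < a" for a
      using riesz_kernel_integrable[OF that bounded_cball, of g \<delta> 0] by simp
    with b two show ?thesis
      unfolding shift f_def[abs_def] by (simp add: set_integral_diff(2) set_integrable_mult_right)
  qed
  have le: "(LINT w:cball g \<delta>|lborel. f w) \<le> (LINT w:cball 0 \<delta>|lborel. f w)" if g: "norm g \<le> \<delta>" for g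
  proof (rule integral_le_by_rearrangement[where c = c])
    show "measure lborel (cball g \<delta>) = measure lborel (cball (0::'a) \<delta>)"
      using \<delta> content_cball[of \<delta> g] content_cball[of \<delta> "0::'a"] by simp
    show "f w \<le> c" if "w \<in> cball g \<delta>" "w \<notin> cball 0 \<delta>" for w
    proof -
      have "norm w \<le> 2 * \<delta>" "\<delta> \<le> norm w"
        using that g norm_triangle_ineq4[of g "g - w"] by (auto simp: dist_norm)
      then show ?thesis
        unfolding f_def c_def using b \<delta>
        by (intro riesz_kernel_minus_quadratic_antimono[OF _ _ \<delta>]) (auto simp: \<kappa>_def)
    qed
    show "AE w in lborel. w \<in> cball 0 \<delta> \<longrightarrow> c \<le> f w"
      using AE_lborel_singleton[of "0::'a"]
    proof eventually_elim
      case (elim w)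
      then show ?case
        unfolding f_def c_def using b \<delta>
        by (intro impI riesz_kernel_minus_quadratic_antimono[OF _ _ \<delta>]) (auto simp: \<kappa>_def)
    qed
  qed (auto intro: int)
  have "(riesz_potential b (cball z \<delta>) (z + h) + riesz_potential b (cball z \<delta>) (z - h)
       - 2 * riesz_potential b (cball z \<delta>) z)
      - \<kappa> * (riesz_potential 2 (cball z \<delta>) (z + h) + riesz_potential 2 (cball z \<delta>) (z - h)
       - 2 * riesz_potential 2 (cball z \<delta>) z) \<le> 0"
    using pot[of h] pot[of "- h"] pot[of 0] le[of h] le[of "- h"] h by (simp add: algebra_simps)
  then show ?thesis unfolding riesz_potential_two_cball by simp
qed

section \<open>Strict midpoint concavity of the potential\<close>

lemma parallel_body_between_balls:
  fixes \<Omega> :: "'a::euclidean_space set"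
  assumes "bounded \<Omega>" "z \<in> \<Omega>" "\<delta> > 0"
  shows "cball z \<delta> \<subseteq> parallel_body \<Omega> \<delta>" "parallel_body \<Omega> \<delta> \<subseteq> cball z (\<delta> + diameter \<Omega>)"
proof -
  show "cball z \<delta> \<subseteq> parallel_body \<Omega> \<delta>"
    using assms by (auto simp: mem_parallel_body_iff dist_norm norm_minus_commute)
  show "parallel_body \<Omega> \<delta> \<subseteq> cball z (\<delta> + diameter \<Omega>)"
  proof
    fix y assume "y \<in> parallel_body \<Omega> \<delta>"
    then obtain w where "w \<in> \<Omega>" "dist w y \<le> \<delta>"
      using assms by (auto simp: mem_parallel_body_iff dist_norm norm_minus_commute)
    then show "y \<in> cball z (\<delta> + diameter \<Omega>)"
      using diameter_bounded_bound[OF assms(1,2), of w] dist_triangle[of z y w] by auto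
  qed
qed

lemma riesz_potential_midpoint_less_convex:
  fixes z :: "'a::euclidean_space"
  assumes b: "2 \<le> b" and h: "h \<noteq> 0" and K: "compact K" "measure lborel K > 0"
  shows "riesz_potential b K (z + h) + riesz_potential b K (z - h) < 2 * riesz_potential b K z"
proof -
  have [measurable]: "K \<in> sets borel" using K by (simp add: borel_compact)
  have b': "- real DIM('a) < b" using b by linarith
  note int = second_difference_integral[OF b' compact_imp_bounded[OF K(1)], of h z]
  let ?g = "\<lambda>y. - (indicat_real K y * second_difference b h (z - y))"
  have intg: "integrable lborel ?g" using int(1) by (simp add: set_integrable_def)
  have ae: "AE y in lborel. second_difference b h (z - y) < 0"
    using AE_lborel_singleton[of "z + h"] AE_lborel_singleton[of "z - h"]
    by eventually_elim (auto intro!: second_difference_neg b h simp: algebra_simps)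
  then have ae': "AE y in lborel. 0 \<le> ?g y"
    by eventually_elim (auto simp: indicator_def)
  have "(LINT y|lborel. ?g y) \<noteq> 0"
  proof
    assume "(LINT y|lborel. ?g y) = 0"
    then have "AE y in lborel. ?g y = 0"
      using integral_nonneg_eq_0_iff_AE[OF intg ae'] by simp
    then have "AE y in lborel. y \<notin> K" using ae by eventually_elim auto
    then have "K \<in> null_sets lborel" by (subst (asm) AE_iff_null) auto
    then show False using K(2) by (auto simp: null_sets_def measure_def)
  qed
  then have "(LINT y|lborel. ?g y) > 0" using integral_nonneg_AE[OF ae'] by linarith
  then show ?thesis using int(2) by (simp add: set_lebesgue_integral_def)
qed

text \<open>The loss on the ball has the factor \<open>2 powr (- m - 2)\<close>, the gain on the shell the factor
  \<open>64 * (m + 2) * 2 powr m\<close> times the relative volume \<open>(1 + t) ^ m - 1\<close> of the shell; their quotient is the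
  left-hand side of the smallness condition.\<close>

lemma riesz_potential_midpoint_less_near_ball:
  fixes z :: "'a::euclidean_space"
  assumes b: "b \<le> 2" "- real DIM('a) < b" and \<delta>: "\<delta> > 0" and h: "h \<noteq> 0" "norm h \<le> \<delta> / 2"
    and K: "cball z \<delta> \<subseteq> K" "K \<subseteq> cball z ((1 + t) * \<delta>)" "K \<in> sets borel" and t: "0 \<le> t" "t \<le> 1"
    and small: "256 * (real DIM('a) + 2) * 4 ^ DIM('a) * ((1 + t) ^ DIM('a) - 1) < 1"
  shows "riesz_potential b K (z + h) + riesz_potential b K (z - h) < 2 * riesz_potential b K z"
proof -
  define m where "m = real DIM('a)"
  define B where "B = cball z \<delta>"
  define v where "v = measure lborel B"
  define D where "D = (\<lambda>y. second_difference b h (z - y))"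
  have [measurable]: "K \<in> sets borel" by fact
  have [measurable]: "B \<in> sets borel" by (simp add: B_def borel_closed)
  have bdd: "bounded B" "bounded K" "bounded (K - B)"
    using K(2) by (auto simp: B_def intro: bounded_subset[OF bounded_cball])
  have BK: "B \<subseteq> K" using K(1) by (simp add: B_def)
  have v: "v > 0" using \<delta> by (simp add: v_def B_def)
  define C where "C = 64 * (m + 2) * 2 powr m * \<delta> powr (b - 2) * (norm h)\<^sup>2"
  have C: "C \<ge> 0" by (simp add: C_def m_def)
  have intD: "set_integrable lborel S D" if "bounded S" "S \<in> sets borel" for S
    unfolding D_def by (rule second_difference_integral(1)[OF b(2) that])
  have outer: "(LINT y:K - B|lborel. D y) \<le> C * (v * ((1 + t) ^ DIM('a) - 1))"
  proof -
    have fin: "emeasure lborel (K - B) < \<infinity>" by (rule emeasure_bounded_finite[OF bdd(3)])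
    have "(LINT y:K - B|lborel. D y) \<le> (LINT y:K - B|lborel. C)"
    proof (rule set_integral_mono)
      show "set_integrable lborel (K - B) (\<lambda>y. C)"
        using fin by (simp add: set_integrable_def)
      fix y assume y: "y \<in> K - B"
      have "norm (z - y) \<le> (1 + t) * \<delta>" using y K(2) by (auto simp: dist_norm)
      also have "\<dots> \<le> 2 * \<delta>" using t \<delta> by (intro mult_right_mono) auto
      finally show "D y \<le> C"
        unfolding D_def C_def using y b \<delta> h
        by (intro second_difference_le_quadratic) (auto simp: B_def dist_norm m_def)
    qed (use bdd in \<open>auto intro: intD\<close>)
    also have "\<dots> = C * measure lborel (K - B)"
      using fin by (simp add: set_lebesgue_integral_def)
    also have "\<dots> \<le> C * (v * ((1 + t) ^ DIM('a) - 1))"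
    proof (rule mult_left_mono[OF _ C])
      have "measure lborel (K - B) = measure lborel K - v"
        unfolding v_def using BK emeasure_bounded_finite[OF bdd(2)]
        by (intro measure_Diff) auto
      moreover have "measure lborel K \<le> measure lborel (cball z ((1 + t) * \<delta>))"
        using K emeasure_bounded_finite[OF bounded_cball, of z "(1 + t) * \<delta>"]
        by (intro measure_mono_fmeasurable) (auto simp: fmeasurable_def borel_closed)
      moreover have "\<dots> = (1 + t) ^ DIM('a) * v"
        using \<delta> t by (simp add: v_def B_def content_cball power_mult_distrib)
      ultimately show "measure lborel (K - B) \<le> v * ((1 + t) ^ DIM('a) - 1)"
        by (simp add: algebra_simps)
    qed
    finally show ?thesis .
  qed
  have "riesz_potential b K (z + h) + riesz_potential b K (z - h) - 2 * riesz_potential b K z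
      = (LINT y:B \<union> (K - B)|lborel. D y)"
    using second_difference_integral(2)[OF b(2) bdd(2), of h z] BK
    by (simp add: D_def Un_absorb1)
  also have "\<dots> = (LINT y:B|lborel. D y) + (LINT y:K - B|lborel. D y)"
    by (intro set_integral_Un intD bdd) auto
  also have "(LINT y:B|lborel. D y) \<le> - (2 powr (- m - 2) * \<delta> powr (b - 2)) * (norm h)\<^sup>2 * v"
    using second_difference_integral(2)[OF b(2) bdd(1), of h z]
      riesz_potential_cball_centre_drop[OF b \<delta>, of h z] h \<delta>
    by (simp add: D_def B_def v_def m_def)
  also note outer
  also have "- (2 powr (- m - 2) * \<delta> powr (b - 2)) * (norm h)\<^sup>2 * v + C * (v * ((1 + t) ^ DIM('a) - 1))
      = 2 powr (- m - 2) * \<delta> powr (b - 2) * (norm h)\<^sup>2 * v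
        * (256 * (m + 2) * 4 ^ DIM('a) * ((1 + t) ^ DIM('a) - 1) - 1)"
  proof -
    have "64 * 2 powr m = 2 powr (- m - 2) * (256 * 4 ^ DIM('a))"
    proof -
      have "4 ^ DIM('a) = 2 powr m * 2 powr m"
        by (simp add: m_def powr_realpow flip: power_mult_distrib)
      moreover have "2 powr (- m - 2) = 1 / (4 * 2 powr m)"
        by (simp add: powr_diff powr_minus powr_numeral field_simps)
      ultimately show ?thesis by simp
    qed
    then have "C = 2 powr (- m - 2) * (256 * 4 ^ DIM('a)) * (m + 2) * \<delta> powr (b - 2) * (norm h)\<^sup>2"
      by (simp add: C_def mult.assoc mult.left_commute[of _ "m + 2"])
    then show ?thesis by (simp add: algebra_simps)
  qed
  also have "\<dots> < 0"
    using small h \<delta> v by (intro mult_pos_neg) (auto simp: m_def)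
  finally show ?thesis by simp
qed

lemma riesz_potential_midpoint_less:
  fixes \<Omega> :: "'a::euclidean_space set"
  assumes \<Omega>: "compact \<Omega>" "convex \<Omega>" and \<delta>: "\<delta> > 0" and b: "- real DIM('a) < b"
    and t: "0 < t" "t \<le> 1" and diam: "diameter \<Omega> \<le> t * \<delta>"
    and small: "256 * (real DIM('a) + 2) * 4 ^ DIM('a) * ((1 + t) ^ DIM('a) - 1) < 1"
    and pq: "p \<in> \<Omega>" "q \<in> \<Omega>" "p \<noteq> q"
  defines "K \<equiv> parallel_body \<Omega> \<delta>"
  shows "riesz_potential b K p + riesz_potential b K q < 2 * riesz_potential b K (midpoint p q)"
proof -
  define z where "z = midpoint p q"
  define h where "h = (1/2) *\<^sub>R (p - q)"
  have p: "p = z + h" and q: "q = z - h"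
    by (simp_all add: z_def h_def midpoint_def flip: scaleR_add_right scaleR_diff_right)
  have h0: "h \<noteq> 0" using pq by (simp add: h_def)
  have zin: "z \<in> \<Omega>"
    using midpoints_in_convex_hull[of p \<Omega> q] pq \<Omega>(2) by (simp add: z_def hull_same)
  have bdd: "bounded \<Omega>" using \<Omega>(1) by (rule compact_imp_bounded)
  have K: "compact K" using \<Omega> by (simp add: K_def compact_parallel_body)
  then have Kb: "K \<in> sets borel" by (rule borel_compact)
  note balls = parallel_body_between_balls[OF bdd zin \<delta>, folded K_def]
  have "riesz_potential b K (z + h) + riesz_potential b K (z - h) < 2 * riesz_potential b K z"
  proof (cases "2 \<le> b")
    case True
    have "measure lborel (cball z \<delta>) \<le> measure lborel K"
      using balls(1) Kb emeasure_bounded_finite[OF compact_imp_bounded[OF K]]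
      by (intro measure_mono_fmeasurable) (auto simp: fmeasurable_def borel_closed)
    moreover have "0 < measure lborel (cball z \<delta>)" using \<delta> by simp
    ultimately show ?thesis
      by (intro riesz_potential_midpoint_less_convex[OF True h0 K]) linarith
  next
    case False
    show ?thesis
    proof (rule riesz_potential_midpoint_less_near_ball[where \<delta> = \<delta> and t = t])
      have "2 * norm h \<le> diameter \<Omega>"
        using diameter_bounded_bound[OF bdd pq(1,2)] by (simp add: h_def dist_norm)
      also note diam
      also have "t * \<delta> \<le> 1 * \<delta>" using t \<delta> by (intro mult_right_mono) auto
      finally show "norm h \<le> \<delta> / 2" by simp
      show "K \<subseteq> cball z ((1 + t) * \<delta>)"
        using balls(2) diam subset_cball[of "\<delta> + diameter \<Omega>" "(1 + t) * \<delta>" z]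
        by (simp add: algebra_simps)
    qed (use False b \<delta> h0 balls Kb t small in auto)
  qed
  then show ?thesis by (simp add: p[symmetric] q[symmetric] z_def[symmetric])
qed

section \<open>Existence and uniqueness of centers\<close>

lemma is_center_iff_riesz_potential:
  fixes K :: "'a::euclidean_space set"
  assumes [measurable]: "K \<in> sets borel"
  shows "is_center \<alpha> K p \<longleftrightarrow>
    (\<forall>x. riesz_potential (\<alpha> - real DIM('a)) K x \<le> riesz_potential (\<alpha> - real DIM('a)) K p)"
proof -
  define b where "b = \<alpha> - real DIM('a)"
  have log: "log_potential K x = riesz_potential b K x" if "b = 0" for x
  proof -
    have "ln (1 / r) = riesz_kernel b r" if "r \<ge> 0" for r :: real
      using that \<open>b = 0\<close> by (cases "r = 0") (auto simp: riesz_kernel_def ln_div)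
    then show ?thesis
      unfolding log_potential_def riesz_potential_def set_lebesgue_integral_def
      by (subst integral_completion) (auto intro!: Bochner_Integration.integral_cong)
  qed
  have pow: "potential \<alpha> K x = - b * riesz_potential b K x" if "b \<noteq> 0" for x
  proof -
    have "potential \<alpha> K x = (LINT y|lborel. indicat_real K y * norm (x - y) powr b)"
      unfolding potential_def set_lebesgue_integral_def b_def
      by (subst integral_completion) auto
    also have "\<dots> = (LINT y|lborel. - b * (indicat_real K y * riesz_kernel b (norm (x - y))))"
      using that by (intro Bochner_Integration.integral_cong) (auto simp: riesz_kernel_def)
    also have "\<dots> = - b * riesz_potential b K x"
      unfolding riesz_potential_def set_lebesgue_integral_def
      by (subst integral_mult_right_zero) simp
    finally show ?thesis .
  qed
  have sign: "real DIM('a) < \<alpha> \<longleftrightarrow> 0 < b" "\<alpha> < real DIM('a) \<longleftrightarrow> b < 0"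
    by (auto simp: b_def)
  consider "b > 0" | "b < 0" | "b = 0" by linarith
  then show ?thesis
    unfolding is_center_def sign b_def[symmetric] by cases (simp_all add: log pow)
qed

lemma parallel_body_unique_center:
  fixes \<Omega> :: "'a::euclidean_space set"
  assumes \<Omega>: "\<Omega> \<noteq> {}" "compact \<Omega>" "convex \<Omega>" and \<delta>: "\<delta> > 0" and \<alpha>: "\<alpha> > 0"
    and t: "0 < t" "t \<le> 1" and diam: "diameter \<Omega> \<le> t * \<delta>"
    and small: "256 * (real DIM('a) + 2) * 4 ^ DIM('a) * ((1 + t) ^ DIM('a) - 1) < 1"
  shows "\<exists>!p. is_center \<alpha> (parallel_body \<Omega> \<delta>) p"
proof -
  define K where "K = parallel_body \<Omega> \<delta>"
  define b where "b = \<alpha> - real DIM('a)"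
  define U where "U = riesz_potential b K"
  have b: "- real DIM('a) < b" using \<alpha> by (simp add: b_def)
  have K: "compact K" "convex K" using \<Omega> by (simp_all add: K_def compact_parallel_body convex_parallel_body)
  have center: "is_center \<alpha> K p \<longleftrightarrow> (\<forall>x. U x \<le> U p)" for p
    using K by (simp add: is_center_iff_riesz_potential borel_compact U_def b_def)
  define c where "c = closest_point \<Omega>"
  have c: "c x \<in> \<Omega>" "x \<notin> \<Omega> \<Longrightarrow> U x < U (c x)" for x
    using closest_point_in_set[of \<Omega> x] riesz_potential_less_closest_point[OF b \<Omega> \<delta>, of x] \<Omega>
    by (auto simp: c_def U_def K_def compact_imp_closed)
  have "continuous_on \<Omega> U"
    using riesz_potential_continuous[OF b K] continuous_on_subset unfolding U_def by blast
  then obtain p where p: "p \<in> \<Omega>" "\<And>x. x \<in> \<Omega> \<Longrightarrow> U x \<le> U p"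
    using continuous_attains_sup[OF \<Omega>(2,1)] by blast
  have "U x \<le> U p" for x
    using p c[of x] by (cases "x \<in> \<Omega>") (auto intro: less_imp_le order_trans)
  then have "is_center \<alpha> K p" by (simp add: center)
  moreover have "q = q'" if "is_center \<alpha> K q" "is_center \<alpha> K q'" for q q'
  proof (rule ccontr)
    assume "q \<noteq> q'"
    moreover have "q \<in> \<Omega>" "q' \<in> \<Omega>" using that c(2) by (auto simp: center not_le[symmetric])
    ultimately have "U q + U q' < 2 * U (midpoint q q')"
      unfolding U_def K_def
      by (intro riesz_potential_midpoint_less[OF \<Omega>(2,3) \<delta> b t diam small])
    moreover have "U (midpoint q q') \<le> U q" "U (midpoint q q') \<le> U q'"
      using that by (auto simp: center)
    ultimately show False by linarith
  qed
  ultimately show ?thesis unfolding K_def by blast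
qed

theorem theorem3p1:
  assumes "CARD('n::finite) \<ge> 2"
  shows "\<exists>\<phi>::real. \<phi> > 0 \<and>
    (\<forall>(\<Omega> :: (real ^ 'n) set) \<delta>::real.
       \<Omega> \<noteq> {} \<longrightarrow> compact \<Omega> \<longrightarrow> convex \<Omega> \<longrightarrow> piecewise_C1_boundary \<Omega> \<longrightarrow>
       \<delta> > 0 \<longrightarrow> \<delta> \<ge> \<phi> * diameter \<Omega> \<longrightarrow>
       (\<forall>\<alpha>::real. \<alpha> > 0 \<longrightarrow> (\<exists>!p. is_center \<alpha> (parallel_body \<Omega> \<delta>) p)))"
proof -
  define m where "m = DIM(real ^ 'n)"
  \<comment> \<open>The left-hand side of the smallness condition; it is continuous and vanishes at \<open>t = 0\<close>.\<close>
  define \<epsilon> where "\<epsilon> t = 256 * (real m + 2) * 4 ^ m * ((1 + t) ^ m - 1)" for t :: real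
  have "(\<epsilon> \<longlongrightarrow> \<epsilon> 0) (at_right 0)"
    unfolding \<epsilon>_def[abs_def] by (intro tendsto_intros)
  then have "eventually (\<lambda>t. \<epsilon> t < 1) (at_right 0)"
    by (rule order_tendstoD) (simp add: \<epsilon>_def)
  moreover have "eventually (\<lambda>t. t \<in> {0<..<1::real}) (at_right 0)"
    by (rule eventually_at_right_real) simp
  ultimately have "eventually (\<lambda>t. \<epsilon> t < 1 \<and> t \<in> {0<..<1}) (at_right 0)"
    by (rule eventually_conj)
  then have "\<exists>t. \<epsilon> t < 1 \<and> t \<in> {0<..<1}"
    by (rule eventually_happens'[OF trivial_limit_at_right_real])
  then obtain t where t: "0 < t" "t < 1" "\<epsilon> t < 1" by auto
  show ?thesis
  proof (intro exI[of _ "1 / t"] conjI allI impI)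
    show "1 / t > 0" using t by simp
    fix \<Omega> :: "(real ^ 'n) set" and \<delta> \<alpha> :: real
    assume "\<Omega> \<noteq> {}" "compact \<Omega>" "convex \<Omega>" "\<delta> > 0" "\<alpha> > 0" "1 / t * diameter \<Omega> \<le> \<delta>"
    then show "\<exists>!p. is_center \<alpha> (parallel_body \<Omega> \<delta>) p"
      using t
      by (intro parallel_body_unique_center[where t = t])
         (simp_all add: \<epsilon>_def m_def pos_divide_le_eq mult.commute del: DIM_cart)
  qed
qed

end
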